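(* Let $\mu$ be a Borel probability measure on $2^\omega$. Suppose $\{A_i: i\in\omega\}$ is a mutually independent family of subsets of $2^\omega$, and let $s_i\in[0,1)$ be such that $\sum_i s_i=\infty$. If player I has a winning strategy in the measure game $G(s_i,A_i)$ for every $i$, then for every $\epsilon$ with $0<\epsilon\le 1$, player I has a winning strategy in $G\big(1-\epsilon,\bigcup_{m=0}^\infty\bigcap_{i=m}^\infty A_i\big)$.
   Context: $2^\omega$ is the space of infinite binary sequences with the product topology; for $t\in 2^{<\omega}$ (finite binary sequences), $N_t=\{x\in 2^\omega: t\subseteq x\}$, and $t^\frown i$ denotes $t$ extended by the digit $i$. For $A\subseteq 2^\omega$ and $s\in[0,1)$ the measure game $G(s,A)$: in round $n$, after II has played $t=x_0\dots x_{n-1}$, player I plays a pair $(m_{t^\frown0},m_{t^\frown1})$, then II plays $x_n$. Put $m_\emptyset=m_0+m_1$. I must obey: every $m_t$ is rational; $m_0+m_1>s$; $0\le m_t\le\mu(N_t)$; if $\mu(N_t)>0$ then $m_t<\mu(N_t)$; $m_{t^\frown0}+m_{t^\frown1}=m_t$. II must obey: $x_n\in\{0,1\}$ and $m_{x_0\dots x_n}\neq0$. The first player to violate a rule loses; otherwise II wins iff $(x_0,x_1,\dots)\in A$. A family $\{A_i:i\in\mathcal I\}$ of subsets of $2^\omega$ is mutually independent if for every finite $F\subseteq\mathcal I$, every choice of $s_i\in[0,1)$ ($i\in F$), and each player $P\in\{\mathrm{I},\mathrm{II}\}$: if $P$ wins $G(s_i,A_i^c)$ for all $i\in F$, then $P$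 wins $G\big(\prod_{i\in F}s_i,\bigcup_{i\in F}A_i^c\big)$. *)

theory Defs
  imports "HOL-Probability.Probability"
begin

text \<open>
  Points of the Cantor space are functions \<^typ>\<open>nat \<Rightarrow> bool\<close>, with \<^term>\<open>False\<close> for the digit 0 and
  \<^term>\<open>True\<close> for the digit 1; the library topology on this type is the product of the discrete ones.
\<close>

definition cylinder :: "bool list \<Rightarrow> (nat \<Rightarrow> bool) set" where
  "cylinder t = {x. \<forall>k<length t. x k = t ! k}"

datatype player = PlayerI | PlayerII

text \<open>
  Round \<open>n\<close> of a run consists of the pair \<open>(m\<^bsub>t0\<^esub>, m\<^bsub>t1\<^esub>)\<close> played by I and the digit played by II,
  where \<open>t\<close> is the word of II's earlier digits.  Runs are always infinite: since the first violation
  of a rule decides the winner, what is played after it is irrelevant.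
\<close>

type_synonym round = "(real \<times> real) \<times> bool"

definition entry :: "real \<times> real \<Rightarrow> bool \<Rightarrow> real" where
  "entry q i = (if i then snd q else fst q)"

definition outcome :: "(nat \<Rightarrow> round) \<Rightarrow> nat \<Rightarrow> bool" where
  "outcome r n = snd (r n)"

definition word :: "(nat \<Rightarrow> round) \<Rightarrow> nat \<Rightarrow> bool list" where
  "word r n = map (outcome r) [0..<n]"

text \<open>\<open>mass r n\<close> is \<open>m\<^bsub>t\<^esub>\<close> for the word \<open>t\<close> of the first \<open>n\<close> digits.\<close>

fun mass :: "(nat \<Rightarrow> round) \<Rightarrow> nat \<Rightarrow> real" where
  "mass r 0 = entry (fst (r 0)) False + entry (fst (r 0)) True"
| "mass r (Suc n) = entry (fst (r n)) (outcome r n)"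

definition admissible_mass :: "(nat \<Rightarrow> bool) measure \<Rightarrow> bool list \<Rightarrow> real \<Rightarrow> bool" where
  "admissible_mass M t q \<longleftrightarrow>
     q \<in> \<rat> \<and> 0 \<le> q \<and> q \<le> measure M (cylinder t) \<and>
     (measure M (cylinder t) > 0 \<longrightarrow> q < measure M (cylinder t))"

definition legal_I :: "(nat \<Rightarrow> bool) measure \<Rightarrow> real \<Rightarrow> (nat \<Rightarrow> round) \<Rightarrow> nat \<Rightarrow> bool" where
  "legal_I M s r n \<longleftrightarrow>
     (n = 0 \<longrightarrow> mass r 0 > s) \<and>
     admissible_mass M (word r n) (mass r n) \<and>
     (\<forall>i. admissible_mass M (word r n @ [i]) (entry (fst (r n)) i)) \<and>
     entry (fst (r n)) False + entry (fst (r n)) True = mass r n"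

definition legal_II :: "(nat \<Rightarrow> round) \<Rightarrow> nat \<Rightarrow> bool" where
  "legal_II r n \<longleftrightarrow> mass r (Suc n) \<noteq> 0"

text \<open>In each round I moves before II.\<close>

fun won_by :: "(nat \<Rightarrow> bool) measure \<Rightarrow> real \<Rightarrow> (nat \<Rightarrow> bool) set \<Rightarrow> player \<Rightarrow> (nat \<Rightarrow> round) \<Rightarrow> bool" where
  "won_by M s A PlayerI r \<longleftrightarrow>
     (\<exists>n. (\<forall>k<n. legal_I M s r k \<and> legal_II r k) \<and> legal_I M s r n \<and> \<not> legal_II r n) \<or>
     (\<forall>n. legal_I M s r n \<and> legal_II r n) \<and> outcome r \<notin> A"
| "won_by M s A PlayerII r \<longleftrightarrow>
     (\<exists>n. (\<forall>k<n. legal_I M s r k \<and> legal_II r k) \<and> \<not> legal_I M s r n) \<or>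
     (\<forall>n. legal_I M s r n \<and> legal_II r n) \<and> outcome r \<in> A"

definition history :: "(nat \<Rightarrow> round) \<Rightarrow> nat \<Rightarrow> round list" where
  "history r n = map r [0..<n]"

definition follows_I :: "(round list \<Rightarrow> real \<times> real) \<Rightarrow> (nat \<Rightarrow> round) \<Rightarrow> bool" where
  "follows_I \<sigma> r \<longleftrightarrow> (\<forall>n. fst (r n) = \<sigma> (history r n))"

definition follows_II :: "(round list \<Rightarrow> real \<times> real \<Rightarrow> bool) \<Rightarrow> (nat \<Rightarrow> round) \<Rightarrow> bool" where
  "follows_II \<tau> r \<longleftrightarrow> (\<forall>n. snd (r n) = \<tau> (history r n) (fst (r n)))"

fun wins_game :: "(nat \<Rightarrow> bool) measure \<Rightarrow> player \<Rightarrow> real \<Rightarrow> (nat \<Rightarrow> bool) set \<Rightarrow> bool" where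
  "wins_game M PlayerI s A \<longleftrightarrow> (\<exists>\<sigma>. \<forall>r. follows_I \<sigma> r \<longrightarrow> won_by M s A PlayerI r)"
| "wins_game M PlayerII s A \<longleftrightarrow> (\<exists>\<tau>. \<forall>r. follows_II \<tau> r \<longrightarrow> won_by M s A PlayerII r)"

text \<open>
  The finite set \<open>F\<close> is nonempty: for \<open>F = {}\<close> the product would be 1, for which no game is defined
  (the parameter has to lie in \<open>[0,1)\<close>).
\<close>

definition mutually_independent ::
    "(nat \<Rightarrow> bool) measure \<Rightarrow> 'i set \<Rightarrow> ('i \<Rightarrow> (nat \<Rightarrow> bool) set) \<Rightarrow> bool" where
  "mutually_independent M I A \<longleftrightarrow>
     (\<forall>F s P. finite F \<and> F \<noteq> {} \<and> F \<subseteq> I \<and> (\<forall>i\<in>F. 0 \<le> s i \<and> s i < 1) \<and>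
        (\<forall>i\<in>F. wins_game M P (s i) (- A i)) \<longrightarrow>
        wins_game M P (\<Prod>i\<in>F. s i) (\<Union>i\<in>F. - A i))"

lemma won_by_exactly_one: "won_by M s A PlayerI r \<longleftrightarrow> \<not> won_by M s A PlayerII r"
proof -
  have first: "(\<exists>n. (\<forall>k<n. P k \<and> Q k) \<and> P n \<and> \<not> Q n) \<or> (\<forall>n. P n \<and> Q n) \<and> \<not> C \<longleftrightarrow>
      \<not> ((\<exists>n. (\<forall>k<n. P k \<and> Q k) \<and> \<not> P n) \<or> (\<forall>n. P n \<and> Q n) \<and> C)"
    for P Q :: "nat \<Rightarrow> bool" and C
  proof (cases "\<forall>n. P n \<and> Q n")
    case True
    then show ?thesis by simp
  next
    case False
    then obtain N where N: "\<not> (P N \<and> Q N)" and less: "\<forall>k<N. P k \<and> Q k"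
      using exists_least_iff[of "\<lambda>n. \<not> (P n \<and> Q n)"] by auto
    have uniq: "n = N" if "\<forall>k<n. P k \<and> Q k" "\<not> (P n \<and> Q n)" for n
      using N less that by (cases n N rule: linorder_cases) simp_all
    have "(\<exists>n. (\<forall>k<n. P k \<and> Q k) \<and> P n \<and> \<not> Q n) \<longleftrightarrow> P N"
      using uniq N less by metis
    moreover have "(\<exists>n. (\<forall>k<n. P k \<and> Q k) \<and> \<not> P n) \<longleftrightarrow> \<not> P N"
      using uniq N less by metis
    ultimately show ?thesis using N by blast
  qed
  show ?thesis unfolding won_by.simps by (rule first)
qed

end

theory Submission
  imports Defs
begin

text \<open>
  A closed set of measure greater than \<open>s\<close> that is disjoint from \<open>A\<close> lets I win \<open>G(s, A)\<close>.  If I wins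
  \<open>G(s\<^sub>i, A\<^sub>i)\<close>, then II wins \<open>G(1 - s\<^sub>i, - A\<^sub>i)\<close>, so by independence II wins
  \<open>G(\<Prod>i\<in>F. 1 - s\<^sub>i, \<Union>i\<in>F. - A\<^sub>i)\<close>, where the product is arbitrarily small for suitable finite sets \<open>F\<close>
  of large indices.  A winning strategy of II in \<open>G(p, B)\<close> in turn yields closed subsets of \<open>B\<close> of measure
  arbitrarily close to \<open>1 - p\<close>.  Intersecting such closed sets, with errors summing to less than \<open>\<epsilon>\<close>,
  gives a closed subset of \<open>\<Inter>m. \<Union>i\<ge>m. - A\<^sub>i\<close> of measure greater than \<open>1 - \<epsilon>\<close>.
\<close>

section \<open>Runs and positions\<close>

lemma word_Suc: "word r (Suc n) = word r n @ [outcome r n]"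
  by (simp add: word_def)

lemma map_snd_history: "map snd (history r n) = word r n"
  by (simp add: word_def history_def outcome_def)

lemma history_Suc: "history r (Suc n) = history r n @ [r n]"
  by (simp add: history_def)

lemma length_history [simp]: "length (history r n) = n"
  by (simp add: history_def)

lemma history_eq_iff: "history r n = history r' n \<longleftrightarrow> (\<forall>k<n. r k = r' k)"
  by (auto simp: history_def)

text \<open>Legality in a round is decided by finitely many moves. This lets a run inherit legality
  from other runs that only share its initial segments.\<close>

lemma legal_cong:
  assumes "history r (Suc n) = history r' (Suc n)"
  shows "legal_I M s r n \<longleftrightarrow> legal_I M s r' n" "legal_II r n \<longleftrightarrow> legal_II r' n"
proof -
  have eq: "r k = r' k" if "k \<le> n" for k
    using assms that by (simp add: history_eq_iff)
  have "mass r k = mass r' k" if "k \<le> Suc n" for k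
    using eq that by (cases k) (auto simp: outcome_def)
  moreover have "word r n = word r' n"
    using eq by (simp add: word_def outcome_def)
  ultimately show "legal_I M s r n \<longleftrightarrow> legal_I M s r' n" "legal_II r n \<longleftrightarrow> legal_II r' n"
    using eq[of n] by (simp_all add: legal_I_def legal_II_def del: mass.simps)
qed

text \<open>Otherwise I's first illegal move would come before any violation by II and hand II the
  win.\<close>

lemma won_by_I_imp_legal_I:
  assumes "won_by M s A PlayerI r" "\<And>k. k < n \<Longrightarrow> legal_II r k"
  shows "legal_I M s r n"
proof (rule ccontr)
  assume "\<not> legal_I M s r n"
  then obtain N where N: "\<not> legal_I M s r N" "\<forall>k<N. legal_I M s r k" "N \<le> n"
    using exists_least_iff[of "\<lambda>n. \<not> legal_I M s r n"] by (metis not_less)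
  then have "won_by M s A PlayerII r" using assms(2) by auto
  then show False using assms(1) won_by_exactly_one by blast
qed

lemma ex_follows_both:
  obtains r where "follows_I \<sigma> r" "follows_II \<tau> r"
proof -
  define hist where "hist n = rec_nat [] (\<lambda>k h. h @ [(\<sigma> h, \<tau> h (\<sigma> h))]) n" for n
  define r where "r n = (\<sigma> (hist n), \<tau> (hist n) (\<sigma> (hist n)))" for n
  have "history r n = hist n" for n
    by (induction n) (simp_all add: history_Suc hist_def r_def, simp add: history_def)
  then show thesis by (intro that[of r]) (simp_all add: follows_I_def follows_II_def r_def)
qed

text \<open>II may ignore I's moves and read the digits off \<open>x\<close>.\<close>

lemma ex_follows_I:
  obtains r where "follows_I \<sigma> r" "outcome r = x"
proof -
  obtain r where r: "follows_I \<sigma> r" "follows_II (\<lambda>h q. x (length h)) r"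
    by (rule ex_follows_both)
  then have "outcome r = x" by (auto simp: follows_II_def outcome_def)
  with r(1) show thesis by (rule that)
qed

text \<open>Once I's strategy is fixed, II's digits determine the whole position. A simulated
  opponent can therefore be reconstructed from the word alone.\<close>

lemma history_cong_follows_I:
  assumes "follows_I \<sigma> r" "follows_I \<sigma> r'" "word r n = word r' n"
  shows "history r n = history r' n"
  using assms(3)
proof (induction n)
  case (Suc n)
  then have "history r n = history r' n" "outcome r n = outcome r' n" by (auto simp: word_Suc)
  then have "r n = r' n"
    using assms(1,2) by (auto simp: follows_I_def outcome_def prod_eq_iff)
  then show ?case using \<open>history r n = history r' n\<close> by (simp add: history_Suc)
qed (simp add: history_def)

text \<open>Dependent choice along histories, used to find an infinite branch through a tree of
  positions.\<close>

lemma ex_sequence_of_extensions: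
  assumes "P []" "\<And>h. P h \<Longrightarrow> \<exists>q. P (h @ [q])"
  obtains r where "\<And>n. P (history r n)"
proof -
  define pick where "pick h = (SOME q. P (h @ [q]))" for h
  define hist where "hist n = rec_nat [] (\<lambda>k h. h @ [pick h]) n" for n
  have P: "P (hist n)" for n
  proof (induction n)
    case (Suc n)
    then show ?case using someI_ex[OF assms(2)] by (simp add: hist_def pick_def)
  qed (simp add: hist_def assms(1))
  have "history (\<lambda>n. pick (hist n)) n = hist n" for n
    by (induction n) (simp_all add: history_Suc hist_def, simp add: history_def)
  then show thesis using P by (intro that[of "\<lambda>n. pick (hist n)"]) simp
qed

section \<open>Cylinders and regularity on the Cantor space\<close>

lemma cylinder_Nil [simp]: "cylinder [] = UNIV"
  by (simp add: cylinder_def)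

lemma mem_cylinder_snoc:
  "x \<in> cylinder (t @ [i]) \<longleftrightarrow> x \<in> cylinder t \<and> x (length t) = i"
  by (auto simp: cylinder_def less_Suc_eq nth_append)

lemma mem_cylinder_word_outcome [simp]: "outcome r \<in> cylinder (word r n)"
  by (simp add: cylinder_def word_def)

lemma cylinder_eq_INT: "cylinder t = (\<Inter>k<length t. (\<lambda>x. x k) -` {t ! k})"
  by (auto simp: cylinder_def)

lemma open_cylinder: "open (cylinder t)"
  unfolding cylinder_eq_INT
  by (intro open_INT finite_lessThan ballI open_vimage)
     (simp_all add: discrete_topology_class.open_discrete continuous_on_product_coordinates)

lemma open_contains_cylinder:
  fixes U :: "(nat \<Rightarrow> bool) set"
  assumes "open U" "x \<in> U"
  obtains n where "cylinder (map x [0..<n]) \<subseteq> U"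
proof -
  have "openin (product_topology (\<lambda>i. euclidean) UNIV) U"
    using assms(1) by (simp add: open_fun_def)
  from product_topology_open_contains_basis[OF this assms(2)]
  obtain X where X: "x \<in> PiE UNIV X" "finite {i. X i \<noteq> (UNIV :: bool set)}" "PiE UNIV X \<subseteq> U"
    by auto
  obtain n where n: "\<And>i. X i \<noteq> UNIV \<Longrightarrow> i < n"
    using finite_nat_set_iff_bounded[of "{i. X i \<noteq> (UNIV :: bool set)}"] X(2) by auto
  have "cylinder (map x [0..<n]) \<subseteq> PiE UNIV X"
  proof
    fix y assume y: "y \<in> cylinder (map x [0..<n])"
    have "y i \<in> X i" for i
      using n[of i] X(1) y by (cases "X i = UNIV") (auto simp: cylinder_def PiE_iff)
    then show "y \<in> PiE UNIV X" by (simp add: PiE_iff)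
  qed
  then show thesis using X(3) by (intro that) blast
qed

lemma closed_memI_cylinder:
  fixes K :: "(nat \<Rightarrow> bool) set"
  assumes "closed K" "\<And>n. cylinder (map x [0..<n]) \<inter> K \<noteq> {}"
  shows "x \<in> K"
proof (rule ccontr)
  assume "x \<notin> K"
  then obtain n where "cylinder (map x [0..<n]) \<subseteq> - K"
    using open_contains_cylinder[of "- K" x] assms(1) by auto
  then show False using assms(2)[of n] by blast
qed

text \<open>There are only countably many words, so every open set is a countable union of
  cylinders, and each cylinder is a finite intersection of coordinate conditions.\<close>

lemma measurable_Cantor_coordinatewise:
  fixes f :: "'a \<Rightarrow> nat \<Rightarrow> bool"
  assumes "\<And>k. {y \<in> space N. f y k} \<in> sets N"
  shows "f \<in> borel_measurable N"
proof (rule borel_measurableI)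
  fix U :: "(nat \<Rightarrow> bool) set" assume "open U"
  have U: "U = (\<Union>t\<in>{t. cylinder t \<subseteq> U}. cylinder t)"
  proof (intro equalityI subsetI)
    fix x assume "x \<in> U"
    then obtain n where "cylinder (map x [0..<n]) \<subseteq> U"
      using open_contains_cylinder \<open>open U\<close> by blast
    moreover have "x \<in> cylinder (map x [0..<n])" by (simp add: cylinder_def)
    ultimately show "x \<in> (\<Union>t\<in>{t. cylinder t \<subseteq> U}. cylinder t)" by blast
  qed blast
  have coord: "{y \<in> space N. f y k = b} \<in> sets N" for k b
  proof (cases b)
    case False
    have "{y \<in> space N. f y k = b} = space N - {y \<in> space N. f y k}" using False by auto
    then show ?thesis using assms[of k] by auto
  qed (use assms[of k] in simp)
  have cyl: "f -` cylinder t \<inter> space N \<in> sets N" for t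
  proof (induction t rule: rev_induct)
    case (snoc i t)
    have "f -` cylinder (t @ [i]) \<inter> space N =
        (f -` cylinder t \<inter> space N) \<inter> {y \<in> space N. f y (length t) = i}"
      by (auto simp: mem_cylinder_snoc)
    then show ?case using snoc coord by auto
  qed simp
  have "f -` U \<inter> space N = (\<Union>t\<in>{t. cylinder t \<subseteq> U}. f -` cylinder t \<inter> space N)"
    by (subst U) blast
  also have "\<dots> \<in> sets N"
    using cyl by (intro sets.countable_UN') auto
  finally show "f -` U \<inter> space N \<in> sets N" .
qed

text \<open>The room in \<open>m < a + b\<close> is what allows a rational choice when nothing
  vanishes. If \<open>a\<close> or \<open>b\<close> is 0, the whole mass goes to the other side; the
  alternatives \<open>= 0\<close> cover this case.\<close>

lemma rational_split:
  fixes m a b :: real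
  assumes "m \<in> \<rat>" "0 \<le> m" "m < a + b \<or> m = 0" "0 \<le> a" "0 \<le> b"
  obtains q where "fst q \<in> \<rat>" "snd q \<in> \<rat>" "0 \<le> fst q" "0 \<le> snd q" "fst q + snd q = m"
    "fst q < a \<or> fst q = 0" "snd q < b \<or> snd q = 0"
proof (cases "m = 0 \<or> a = 0 \<or> b = 0")
  case True
  then consider "m = 0" | "a = 0" "m \<noteq> 0" | "b = 0" "m \<noteq> 0" by blast
  then show thesis
  proof cases
    case 1
    then show thesis using that[of "(0, 0)"] by simp
  next
    case 2
    then show thesis using that[of "(0, m)"] assms by simp
  next
    case 3
    then show thesis using that[of "(m, 0)"] assms by simp
  qed
next
  case False
  then have "max 0 (m - b) < min a m" using assms by auto
  then obtain c where c: "c \<in> \<rat>" "max 0 (m - b) < c" "c < min a m"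
    using Rats_dense_in_real by blast
  then show thesis using that[of "(c, m - c)"] assms by auto
qed

section \<open>Approximation of sets from inside and outside for Borel probability measures\<close>

locale Cantor_probability = prob_space M for M :: "(nat \<Rightarrow> bool) measure" +
  assumes sets_eq_borel: "sets M = sets borel"
begin

lemma space_eq_UNIV: "space M = UNIV"
  using sets_eq_imp_space_eq[OF sets_eq_borel] by simp

lemma sets_cylinder [simp]: "cylinder t \<in> sets M"
  using open_cylinder by (simp add: sets_eq_borel)

lemma prob_Int_cylinder_split:
  assumes "X \<in> sets M"
  shows "prob (X \<inter> cylinder t) =
    prob (X \<inter> cylinder (t @ [False])) + prob (X \<inter> cylinder (t @ [True]))"
proof -
  have "X \<inter> cylinder t = (X \<inter> cylinder (t @ [False])) \<union> (X \<inter> cylinder (t @ [True]))"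
    by (auto simp: mem_cylinder_snoc)
  moreover have "(X \<inter> cylinder (t @ [False])) \<inter> (X \<inter> cylinder (t @ [True])) = {}"
    by (auto simp: mem_cylinder_snoc)
  ultimately show ?thesis
    using assms by (metis finite_measure_Union sets.Int sets_cylinder)
qed

text \<open>The measure is pushed to the Polish space of real sequences along the 0-1 coding
  \<open>f\<close>. Inner regularity there yields a compact set, whose preimage under the continuous
  \<open>f\<close> is closed.\<close>

lemma closed_inner_approximation:
  assumes X: "X \<in> sets M" and c: "c < prob X"
  obtains K where "closed K" "K \<subseteq> X" "c < prob K"
proof (cases "c < 0")
  case True
  then show thesis using that[of "{}"] by simp
next
  case False
  define f :: "(nat \<Rightarrow> bool) \<Rightarrow> nat \<Rightarrow> real" where "f x = (\<lambda>k. of_bool (x k))" for x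
  define g :: "(nat \<Rightarrow> real) \<Rightarrow> nat \<Rightarrow> bool" where "g y = (\<lambda>k. y k > 1 / 2)" for y
  have gf: "g (f x) = x" for x by (auto simp: f_def g_def)
  have cont: "continuous_on UNIV f"
    unfolding f_def
  proof (rule continuous_on_coordinatewise_then_product)
    fix k
    have "continuous_on UNIV (of_bool :: bool \<Rightarrow> real)"
      by (simp add: continuous_on_open_vimage discrete_topology_class.open_discrete)
    from continuous_on_compose2[OF this continuous_on_product_coordinates[of k]]
    show "continuous_on UNIV (\<lambda>x :: nat \<Rightarrow> bool. of_bool (x k) :: real)" by simp
  qed
  have f_meas: "f \<in> measurable M borel"
    using borel_measurable_continuous_onI[OF cont] measurable_cong_sets[OF sets_eq_borel refl] by blast
  have g_meas: "g \<in> measurable borel borel"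
  proof (rule measurable_Cantor_coordinatewise)
    fix k
    have "open {y :: nat \<Rightarrow> real. 1 / 2 < y k}"
      by (intro open_Collect_less continuous_on_const continuous_on_product_coordinates)
    then show "{y \<in> space borel. g y k} \<in> sets borel" by (simp add: g_def)
  qed
  have X': "g -` X \<in> sets borel"
    using measurable_sets[OF g_meas, of X] X by (simp add: sets_eq_borel)
  define D where "D = distr M borel f"
  have "prob_space D" unfolding D_def by (rule prob_space_distr[OF f_meas])
  then interpret D: prob_space D .
  have "emeasure D (g -` X) = emeasure M X"
    using X' f_meas by (simp add: D_def emeasure_distr space_eq_UNIV vimage_def gf)
  also have "\<dots> > ennreal c"
    using c False by (simp add: emeasure_eq_measure ennreal_less_iff)
  finally have "ennreal c < (SUP K \<in> {K. K \<subseteq> g -` X \<and> compact K}. emeasure D K)"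
    using inner_regular[of D "g -` X"] X' D.emeasure_space_1 by (simp add: D_def)
  then obtain K where K: "K \<subseteq> g -` X" "compact K" "ennreal c < emeasure D K"
    by (auto simp: less_SUP_iff)
  have "closed K" using K(2) by (rule compact_imp_closed)
  have "emeasure D K = emeasure M (f -` K)"
    using \<open>closed K\<close> f_meas by (simp add: D_def emeasure_distr space_eq_UNIV)
  then have "c < prob (f -` K)"
    using K(3) False by (simp add: emeasure_eq_measure ennreal_less_iff)
  moreover have "closed (f -` K)"
    using \<open>closed K\<close> cont by (rule closed_vimage)
  moreover have "f -` K \<subseteq> X" using K(1) gf by fastforce
  ultimately show thesis using that by blast
qed

text \<open>The infimum of the measures of measurable supersets is attained by intersecting a
  minimizing sequence. Cutting the result with another superset \<open>T\<close> cannot lower the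
  measure further.\<close>

lemma measurable_hull:
  obtains S where "S \<in> sets M" "X \<subseteq> S"
    "\<And>T. T \<in> sets M \<Longrightarrow> X \<subseteq> T \<Longrightarrow> prob (S - T) = 0"
proof -
  define C where "C = {T \<in> sets M. X \<subseteq> T}"
  have ne: "UNIV \<in> C" using sets.top[of M] by (simp add: C_def space_eq_UNIV)
  define c where "c = (INF T\<in>C. prob T)"
  have bdd: "bdd_below (prob ` C)" by (rule bdd_belowI2[of _ 0]) simp
  have "\<exists>T\<in>C. prob T < c + inverse (real (Suc n))" for n
    using cInf_lessD[of "prob ` C" "c + inverse (real (Suc n))"] ne unfolding c_def by auto
  then obtain T where T: "\<And>n. T n \<in> C" "\<And>n. prob (T n) < c + inverse (real (Suc n))"
    by metis
  define S where "S = (\<Inter>n. T n)"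
  have S: "S \<in> C" using T(1) by (auto simp: C_def S_def)
  have "prob S \<le> c"
  proof (rule field_le_epsilon)
    fix e :: real assume "0 < e"
    then obtain n where n: "inverse (real (Suc n)) < e" using reals_Archimedean by blast
    have "prob S \<le> prob (T n)"
      using T(1)[of n] by (intro finite_measure_mono) (auto simp: S_def C_def)
    then show "prob S \<le> c + e" using T(2)[of n] n by linarith
  qed
  show thesis
  proof (rule that)
    show "S \<in> sets M" "X \<subseteq> S" using S by (auto simp: C_def)
    fix V assume V: "V \<in> sets M" "X \<subseteq> V"
    have "S \<inter> V \<in> C" using S V by (auto simp: C_def)
    then have "c \<le> prob (S \<inter> V)" unfolding c_def by (rule cINF_lower[OF bdd])
    moreover have "prob (S - V) = prob S - prob (S \<inter> V)"
      using S V by (subst finite_measure_Diff') (auto simp: C_def)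
    ultimately show "prob (S - V) = 0"
      using \<open>prob S \<le> c\<close> measure_nonneg[of M "S - V"] by linarith
  qed
qed

section \<open>Strategies\<close>

lemma admissible_massI:
  assumes "q \<in> \<rat>" "0 \<le> q" "q < c \<or> q = 0" "c \<le> prob (cylinder t)"
  shows "admissible_mass M t q"
  using assms by (auto simp: admissible_mass_def)

lemma prob_cylinder_split:
  "prob (cylinder t) = prob (cylinder (t @ [False])) + prob (cylinder (t @ [True]))"
  using prob_Int_cylinder_split[of UNIV t] sets.top[of M] by (simp add: space_eq_UNIV)

text \<open>I keeps every \<open>m\<^bsub>t\<^esub>\<close> below the measure of \<open>K\<close> inside the cylinder of \<open>t\<close>, or equal to 0.\<close>

lemma wins_game_I_if_closed:
  assumes K: "closed K" "K \<inter> A = {}" and s: "0 \<le> s" "s < prob K"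
  shows "wins_game M PlayerI s A"
proof -
  define w where "w t = prob (K \<inter> cylinder t)" for t
  have K_sets: "K \<in> sets M" using K(1) by (simp add: sets_eq_borel)
  have w_split: "w t = w (t @ [False]) + w (t @ [True])" for t
    unfolding w_def by (rule prob_Int_cylinder_split[OF K_sets])
  have w_le: "w t \<le> prob (cylinder t)" for t
    unfolding w_def by (intro finite_measure_mono) auto
  \<comment> \<open>\<open>m0\<close> serves as the total mass at the empty word.\<close>
  obtain m0 where m0: "m0 \<in> \<rat>" "s < m0" "m0 < prob K"
    using Rats_dense_in_real s(2) by blast
  define good where "good q m a b \<longleftrightarrow> fst q \<in> \<rat> \<and> snd q \<in> \<rat> \<and> 0 \<le> fst q \<and> 0 \<le> snd q \<and>
    fst q + snd q = m \<and> (fst q < a \<or> fst q = 0) \<and> (snd q < b \<or> snd q = 0)"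
    for q :: "real \<times> real" and m a b
  define cur where "cur h = (if h = [] then m0 else entry (fst (last h)) (snd (last h)))"
    for h :: "round list"
  \<comment> \<open>On runs following \<open>\<sigma>\<close>, the invariant \<open>ok\<close> below
    guarantees that such a pair exists; elsewhere the value is arbitrary.\<close>
  define \<sigma> where "\<sigma> h = (SOME q. good q (cur h) (w (map snd h @ [False])) (w (map snd h @ [True])))"
    for h :: "round list"
  have "won_by M s A PlayerI r" if follows: "follows_I \<sigma> r" for r
  proof -
    define ok where "ok q t \<longleftrightarrow> q \<in> \<rat> \<and> 0 \<le> q \<and> (q < w t \<or> q = 0)" for q t
    have good: "good (fst (r n)) (cur (history r n)) (w (word r n @ [False])) (w (word r n @ [True]))"
      if "ok (cur (history r n)) (word r n)" for n
    proof -
      have "\<exists>q. good q (cur (history r n)) (w (word r n @ [False])) (w (word r n @ [True]))"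
      proof (rule rational_split[of "cur (history r n)" "w (word r n @ [False])" "w (word r n @ [True])"])
        show "cur (history r n) < w (word r n @ [False]) + w (word r n @ [True]) \<or> cur (history r n) = 0"
          using that w_split[of "word r n"] by (simp add: ok_def)
      qed (use that in \<open>auto simp: ok_def good_def w_def\<close>)
      then have "good (\<sigma> (history r n)) (cur (history r n)) (w (word r n @ [False])) (w (word r n @ [True]))"
        unfolding \<sigma>_def map_snd_history by (rule someI_ex)
      then show ?thesis using follows by (simp add: follows_I_def)
    qed
    have ok_cur: "ok (cur (history r n)) (word r n)" for n
    proof (induction n)
      case 0
      then show ?case using m0 s by (simp add: ok_def cur_def history_def word_def w_def)
    next
      case (Suc n)
      show ?case
        using good[OF Suc]
        by (auto simp: ok_def good_def cur_def history_Suc word_Suc entry_def outcome_def)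
    qed
    note good = good[OF ok_cur]
    have mass_eq: "mass r n = cur (history r n)" for n
    proof (cases n)
      case 0
      then show ?thesis using good[of 0] by (simp add: good_def entry_def)
    next
      case (Suc k)
      then show ?thesis by (simp add: cur_def history_Suc outcome_def)
    qed
    have legal: "legal_I M s r n" for n
      unfolding legal_I_def
    proof (intro conjI impI allI)
      show "mass r 0 > s" using m0 by (simp add: mass_eq[of 0] cur_def history_def del: mass.simps)
      show "admissible_mass M (word r n) (mass r n)"
        using ok_cur[of n] w_le[of "word r n"] unfolding mass_eq ok_def
        by (intro admissible_massI) auto
      show "entry (fst (r n)) False + entry (fst (r n)) True = mass r n"
        using good[of n] unfolding mass_eq by (simp add: good_def entry_def)
      show "admissible_mass M (word r n @ [i]) (entry (fst (r n)) i)" for i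
        using good[of n] w_le[of "word r n @ [i]"]
        by (intro admissible_massI[of _ "w (word r n @ [i])"]) (auto simp: good_def entry_def)
    qed
    show ?thesis
    proof (cases "\<forall>n. legal_II r n")
      case True
      \<comment> \<open>II's rule concerns masses from index \<open>Suc n\<close> on, so the
        cylinder of length \<open>Suc n\<close> is shown to meet \<open>K\<close>; the one of length
        \<open>n\<close> contains it.\<close>
      have "outcome r \<in> K"
      proof (rule closed_memI_cylinder[OF K(1)])
        fix n
        have "mass r (Suc n) \<noteq> 0" using True by (simp add: legal_II_def)
        then have "0 < w (word r (Suc n))"
          using ok_cur[of "Suc n"] unfolding mass_eq ok_def by linarith
        then have "K \<inter> cylinder (word r (Suc n)) \<noteq> {}" by (auto simp: w_def)
        then show "cylinder (map (outcome r) [0..<n]) \<inter> K \<noteq> {}"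
          by (auto simp: word_Suc mem_cylinder_snoc) (auto simp: word_def)
      qed
      then show ?thesis using True legal K(2) by auto
    next
      case False
      then obtain n where "\<not> legal_II r n" "\<forall>k<n. legal_II r k"
        using exists_least_iff[of "\<lambda>n. \<not> legal_II r n"] by auto
      then show ?thesis using legal by auto
    qed
  qed
  then show ?thesis by auto
qed

text \<open>
  Against a run with masses \<open>m\<close>, player II imagines I's given strategy playing masses \<open>m'\<close> along the
  same digits, and maintains \<open>prob (cylinder t) < m\<^bsub>t\<^esub> + m'\<^bsub>t\<^esub>\<close>.
\<close>

lemma wins_game_II_complement:
  assumes "wins_game M PlayerI s A"
  shows "wins_game M PlayerII (1 - s) (- A)"
proof -
  obtain \<sigma> where \<sigma>: "\<And>r. follows_I \<sigma> r \<Longrightarrow> won_by M s A PlayerI r"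
    using assms by auto
  define sim where "sim x = (SOME r. follows_I \<sigma> r \<and> outcome r = x)" for x
  have sim: "follows_I \<sigma> (sim x)" "outcome (sim x) = x" for x
    using someI_ex[of "\<lambda>r. follows_I \<sigma> r \<and> outcome r = x"] ex_follows_I[of \<sigma> x]
    unfolding sim_def by blast+
  \<comment> \<open>I's imagined next move after the word \<open>t\<close>. Padding \<open>t\<close>
    with the digit 0 is harmless, since only the first \<open>length t\<close> digits affect
    it.\<close>
  define guess where "guess t = entry (\<sigma> (history (sim (\<lambda>k. k < length t \<and> t ! k)) (length t)))" for t
  \<comment> \<open>II plays 1 if the invariant survives there and 0 otherwise. Adding over both
    digits shows that it survives at one of them.\<close>
  define \<tau> where "\<tau> h q \<longleftrightarrow>
      prob (cylinder (map snd h @ [True])) < entry q True + guess (map snd h) True"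
    for h :: "round list" and q
  have "won_by M (1 - s) (- A) PlayerII r" if follows: "follows_II \<tau> r" for r
  proof (rule ccontr)
    assume "\<not> won_by M (1 - s) (- A) PlayerII r"
    then have won: "won_by M (1 - s) (- A) PlayerI r"
      using won_by_exactly_one by blast
    define r' where "r' = sim (outcome r)"
    have r': "won_by M s A PlayerI r'" "follows_I \<sigma> r'" "outcome r' = outcome r"
      using sim \<sigma> by (auto simp: r'_def simp del: won_by.simps)
    have word: "word r' n = word r n" for n by (simp add: word_def r'(3))
    have guess: "guess (word r n) = entry (fst (r' n))" for n
    proof -
      let ?x = "\<lambda>k. k < length (word r n) \<and> word r n ! k"
      have "word (sim ?x) n = word r' n"
        unfolding word by (auto simp: word_def sim(2))
      from history_cong_follows_I[OF sim(1) r'(2) this]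
      show ?thesis using r'(2) by (simp add: guess_def follows_I_def word_def)
    qed
    have step: "prob (cylinder (word r (Suc n))) < mass r (Suc n) + mass r' (Suc n)"
      if "legal_I M (1 - s) r n" "legal_I M s r' n"
        "prob (cylinder (word r n)) < mass r n + mass r' n" for n
    proof -
      have sum: "prob (cylinder (word r n @ [False])) + prob (cylinder (word r n @ [True])) <
         (entry (fst (r n)) False + entry (fst (r' n)) False)
         + (entry (fst (r n)) True + entry (fst (r' n)) True)"
        using that prob_cylinder_split[of "word r n"] unfolding legal_I_def by linarith
      have "outcome r n \<longleftrightarrow>
          prob (cylinder (word r n @ [True])) < entry (fst (r n)) True + entry (fst (r' n)) True"
        using follows unfolding follows_II_def \<tau>_def map_snd_history guess outcome_def by blast
      then show ?thesis
        using sum r'(3) by (cases "outcome r n") (auto simp: word_Suc)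
    qed
    have inv: "prob (cylinder (word r (Suc n))) < mass r (Suc n) + mass r' (Suc n) \<and>
        legal_II r n \<and> legal_II r' n"
      if "\<And>k. k \<le> n \<Longrightarrow> legal_I M (1 - s) r k" for n
      using that
    proof (induction n rule: less_induct)
      case (less n)
      have leg: "legal_I M (1 - s) r n" using less.prems by simp
      have leg': "legal_I M s r' n"
        using won_by_I_imp_legal_I[OF r'(1)] less.IH less.prems by auto
      \<comment> \<open>At the start the two masses exceed \<open>1 - s\<close> and
        \<open>s\<close>, so their sum exceeds the total measure 1.\<close>
      have "prob (cylinder (word r n)) < mass r n + mass r' n"
      proof (cases n)
        case 0
        then show ?thesis
          using leg leg' prob_space by (auto simp: legal_I_def word_def space_eq_UNIV)
      next
        case (Suc k)
        then show ?thesis using less.IH[of k] less.prems by auto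
      qed
      from step[OF leg leg' this]
      have *: "prob (cylinder (word r (Suc n))) < mass r (Suc n) + mass r' (Suc n)" .
      \<comment> \<open>Neither mass alone exceeds the measure of the cylinder while the sum does,
        so both are positive and II's digit is legal in both runs.\<close>
      have "mass r (Suc n) \<le> prob (cylinder (word r (Suc n)))"
        "mass r' (Suc n) \<le> prob (cylinder (word r (Suc n)))"
        using leg leg' r'(3) word by (auto simp: legal_I_def admissible_mass_def word_Suc)
      then show ?case using * by (auto simp: legal_II_def)
    qed
    from won show False
    proof (simp only: won_by.simps, elim disjE exE conjE)
      fix n assume *: "\<forall>k<n. legal_I M (1 - s) r k \<and> legal_II r k" "legal_I M (1 - s) r n" "\<not> legal_II r n"
      then have "legal_I M (1 - s) r k" if "k \<le> n" for k
        using that by (cases "k = n") auto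
      then show False using inv * by blast
    next
      assume *: "\<forall>n. legal_I M (1 - s) r n \<and> legal_II r n" "outcome r \<notin> - A"
      then have "legal_II r' n" for n using inv by blast
      then have "outcome r' \<notin> A" using r'(1) by auto
      then show False using * r'(3) by simp
    qed
  qed
  then show ?thesis by auto
qed

section \<open>Regularity from a winning strategy of II\<close>

text \<open>
  The outcomes of the legal runs in which II follows a winning strategy form a set obtained by the
  Souslin operation over the countably many positions with rational masses.  As for analytic sets in
  general, replacing the outcomes beyond each position by a measurable hull only adds a null set.
\<close>

lemma closed_subset_if_wins_game_II:
  assumes win: "wins_game M PlayerII p B" and p: "0 \<le> p" and c: "c < 1 - p"
  obtains K where "closed K" "K \<subseteq> B" "c < prob K"
proof -
  obtain \<tau> where \<tau>: "\<And>r. follows_II \<tau> r \<Longrightarrow> won_by M p B PlayerII r"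
    using win by auto
  define run where "run r \<longleftrightarrow> follows_II \<tau> r \<and> (\<forall>n. legal_I M p r n \<and> legal_II r n)" for r
  \<comment> \<open>The outcomes of the legal runs through the position \<open>h\<close>;
    \<open>R []\<close> is the whole set of outcomes, a subset of \<open>B\<close>.\<close>
  define R where "R h = outcome ` {r. run r \<and> history r (length h) = h}" for h
  have run_B: "outcome r \<in> B" if "run r" for r
    using \<tau>[of r] that by (auto simp: run_def)
  have R_cyl: "R h \<subseteq> cylinder (map snd h)" for h
  proof
    fix x assume "x \<in> R h"
    then obtain r where "history r (length h) = h" "x = outcome r" by (auto simp: R_def)
    then show "x \<in> cylinder (map snd h)"
      using mem_cylinder_word_outcome[of r "length h"] map_snd_history[of r "length h"] by simp
  qed
  define Q :: "round set" where "Q = (\<rat> \<times> \<rat>) \<times> UNIV"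
  have Q_count: "countable Q" by (auto simp: Q_def countable_rat)
  have run_Q: "r n \<in> Q" if "run r" for r n
  proof -
    have "admissible_mass M (word r n @ [i]) (entry (fst (r n)) i)" for i
      using that by (auto simp: run_def legal_I_def)
    from this[of False] this[of True] show ?thesis
      by (auto simp: Q_def admissible_mass_def entry_def mem_Times_iff)
  qed
  have R_step: "R h \<subseteq> (\<Union>q\<in>Q. R (h @ [q]))" for h
  proof
    fix x assume "x \<in> R h"
    then obtain r where r: "run r" "history r (length h) = h" "x = outcome r"
      by (auto simp: R_def)
    then have "x \<in> R (h @ [r (length h)])" by (auto simp: R_def history_Suc)
    then show "x \<in> (\<Union>q\<in>Q. R (h @ [q]))" using run_Q[OF r(1)] by blast
  qed
  \<comment> \<open>The hull is trimmed in two ways. Emptiness over dead positions keeps the branch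
    found below on positions of genuine runs; the cylinder bound makes the digits of the branch
    those of the given point.\<close>
  have "\<exists>S. S \<in> sets M \<and> R h \<subseteq> S \<and> S \<subseteq> cylinder (map snd h) \<and> (R h = {} \<longrightarrow> S = {}) \<and>
      (\<forall>T\<in>sets M. R h \<subseteq> T \<longrightarrow> prob (S - T) = 0)" for h
  proof (cases "R h = {}")
    case False
    obtain S where S: "S \<in> sets M" "R h \<subseteq> S"
      "\<And>T. T \<in> sets M \<Longrightarrow> R h \<subseteq> T \<Longrightarrow> prob (S - T) = 0"
      using measurable_hull by metis
    have "prob (S \<inter> cylinder (map snd h) - T) = 0" if "T \<in> sets M" "R h \<subseteq> T" for T
      using S(3)[OF that] finite_measure_mono[of "S \<inter> cylinder (map snd h) - T" "S - T"] S(1) that(1)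
        measure_nonneg[of M "S \<inter> cylinder (map snd h) - T"] by auto
    then show ?thesis
      using S R_cyl False by (intro exI[of _ "S \<inter> cylinder (map snd h)"]) auto
  qed (intro exI[of _ "{}"], simp)
  then obtain S where S: "\<And>h. S h \<in> sets M" "\<And>h. R h \<subseteq> S h" "\<And>h. S h \<subseteq> cylinder (map snd h)"
      "\<And>h. R h = {} \<Longrightarrow> S h = {}" "\<And>h T. T \<in> sets M \<Longrightarrow> R h \<subseteq> T \<Longrightarrow> prob (S h - T) = 0"
    by metis
  define U where "U h = (\<Union>q\<in>Q. S (h @ [q]))" for h
  have U: "U h \<in> sets M" "R h \<subseteq> U h" for h
  proof -
    show "U h \<in> sets M" unfolding U_def using S(1) Q_count by (intro sets.countable_UN') auto
    have "(\<Union>q\<in>Q. R (h @ [q])) \<subseteq> U h" unfolding U_def by (intro UN_mono S(2) order_refl)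
    with R_step show "R h \<subseteq> U h" by (rule order_trans)
  qed
  \<comment> \<open>\<open>Z\<close> collects the points that lie in some hull but in none of the
    hulls one round later. Outside \<open>Z\<close> a point of \<open>S h\<close> can always be
    followed one round further.\<close>
  define Z where "Z = (\<Union>h\<in>lists Q. S h - U h)"
  have "S h - U h \<in> null_sets M" for h
    using S(1,5) U by (intro null_setsI) (auto simp: emeasure_eq_measure)
  then have Z: "Z \<in> null_sets M"
    unfolding Z_def using countable_lists[OF Q_count] by (intro null_sets_UN') auto
  have Souslin: "S [] - Z \<subseteq> R []"
  proof
    fix x assume x: "x \<in> S [] - Z"
    obtain r where r: "\<And>n. history r n \<in> lists Q \<and> x \<in> S (history r n)"
    proof (rule ex_sequence_of_extensions[of "\<lambda>h. h \<in> lists Q \<and> x \<in> S h"])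
      show "\<exists>q. h @ [q] \<in> lists Q \<and> x \<in> S (h @ [q])" if "h \<in> lists Q \<and> x \<in> S h" for h
      proof -
        have "x \<in> U h" using that x unfolding Z_def by blast
        then obtain q where "q \<in> Q" "x \<in> S (h @ [q])" unfolding U_def by blast
        then show ?thesis using that by (intro exI[of _ q]) simp
      qed
    qed (use x in auto)
    have approx: "\<exists>r'. run r' \<and> history r' n = history r n" for n
      using r[of n] S(4)[of "history r n"] by (auto simp: R_def)
    have "snd (r n) = \<tau> (history r n) (fst (r n)) \<and>
        legal_I M p r n \<and> legal_II r n" for n
    proof -
      obtain r' where r': "run r'" "history r' (Suc n) = history r (Suc n)"
        using approx by blast
      then have "r' n = r n" "history r' n = history r n" by (simp_all add: history_eq_iff)
      then show ?thesis
        using r' legal_cong[OF r'(2)] by (auto simp: run_def follows_II_def dest: spec[of _ n])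
    qed
    then have "run r" by (auto simp: run_def follows_II_def)
    moreover have "outcome r = x"
    proof
      fix n
      have "x \<in> cylinder (word r (Suc n))"
        using r[of "Suc n"] S(3)[of "history r (Suc n)"] by (auto simp: map_snd_history)
      then show "outcome r n = x n" by (simp add: word_Suc mem_cylinder_snoc, simp add: word_def)
    qed
    ultimately show "x \<in> R []" by (auto simp: R_def history_def)
  qed
  \<comment> \<open>Otherwise I could force the outcome into a closed set missing
    \<open>S []\<close>. Played against \<open>\<tau>\<close>, this gives a legal run whose outcome
    lies in \<open>R []\<close>, hence in \<open>S []\<close>.\<close>
  have "1 - p \<le> prob (S [])"
  proof (rule ccontr)
    assume "\<not> 1 - p \<le> prob (S [])"
    then have "p < prob (space M - S [])" using S(1) by (simp add: prob_compl)
    then obtain K where K: "closed K" "K \<subseteq> space M - S []" "p < prob K"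
      by (rule closed_inner_approximation[OF sets.compl_sets[OF S(1)]])
    have "wins_game M PlayerI p (- K)"
      using K p by (intro wins_game_I_if_closed[of K]) auto
    then obtain \<sigma> where \<sigma>: "\<And>r. follows_I \<sigma> r \<Longrightarrow> won_by M p (- K) PlayerI r" by auto
    obtain r where r: "follows_I \<sigma> r" "follows_II \<tau> r" by (rule ex_follows_both)
    have I: "won_by M p (- K) PlayerI r" and II: "won_by M p B PlayerII r"
      using \<sigma> \<tau> r by blast+
    have "\<not> won_by M p B PlayerI r" using II won_by_exactly_one by blast
    then have "(\<forall>n. legal_I M p r n \<and> legal_II r n) \<and> outcome r \<in> K"
      using I by auto
    then have "outcome r \<in> K \<inter> R []" using r(2) by (auto simp: R_def run_def history_def)
    then show False using K(2) S(2) by auto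
  qed
  then have "c < prob (S [] - Z)"
    using c measure_Diff_null_set[OF S(1) Z] by simp
  then obtain K where "closed K" "K \<subseteq> S [] - Z" "c < prob K"
    by (rule closed_inner_approximation[OF sets.Diff[OF S(1) null_setsD2[OF Z]]])
  then show thesis using Souslin run_B by (intro that[of K]) (auto simp: R_def)
qed

end

section \<open>The second Borel--Cantelli lemma for measure games\<close>

text \<open>From \<open>1 - x \<le> exp (- x)\<close>, the product is at most the exponential of
  minus a tail sum, and tail sums are unbounded.\<close>

lemma prod_one_minus_tail_small:
  fixes s :: "nat \<Rightarrow> real"
  assumes s: "\<And>i. 0 \<le> s i \<and> s i < 1"
    and div: "filterlim (\<lambda>n. \<Sum>i<n. s i) at_top sequentially" and d: "0 < d" "d < 1"
  obtains F where "finite F" "F \<noteq> {}" "F \<subseteq> {m..}" "\<And>i. i \<in> F \<Longrightarrow> 0 < s i" "(\<Prod>i\<in>F. 1 - s i) < d"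
proof -
  have "eventually (\<lambda>n. (\<Sum>i<n. s i) > (\<Sum>i<m. s i) - ln d) sequentially"
    using div by (simp add: filterlim_at_top_dense)
  then obtain n where n: "m \<le> n" "(\<Sum>i<n. s i) > (\<Sum>i<m. s i) - ln d"
    using eventually_happens[OF eventually_conj[OF eventually_ge_at_top[of m]]] by fastforce
  \<comment> \<open>Zero terms are dropped so that each \<open>1 - s i\<close> is below 1, as a game
    parameter in the independence hypothesis must be.\<close>
  define F where "F = {i\<in>{m..<n}. s i \<noteq> 0}"
  have "(\<Sum>i<n. s i) = (\<Sum>i<m. s i) + (\<Sum>i=m..<n. s i)"
    using sum.atLeastLessThan_concat[of 0 m n s] n(1) by (simp add: atLeast0LessThan)
  moreover have "(\<Sum>i\<in>F. s i) = (\<Sum>i=m..<n. s i)"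
    unfolding F_def by (intro sum.mono_neutral_left) auto
  ultimately have large: "- (\<Sum>i\<in>F. s i) < ln d" using n(2) by simp
  have "(\<Prod>i\<in>F. 1 - s i) \<le> (\<Prod>i\<in>F. exp (- s i))"
  proof (intro prod_mono conjI)
    fix i
    show "0 \<le> 1 - s i" using s[of i] by simp
    show "1 - s i \<le> exp (- s i)" using exp_ge_add_one_self[of "- s i"] by simp
  qed
  also have "\<dots> = exp (- (\<Sum>i\<in>F. s i))" by (simp add: exp_sum F_def sum_negf[symmetric])
  also have "\<dots> < exp (ln d)" using large by simp
  finally have prod: "(\<Prod>i\<in>F. 1 - s i) < d" using d by simp
  \<comment> \<open>The empty product would be 1, which exceeds \<open>d\<close>.\<close>
  moreover have "F \<noteq> {}" using prod d by auto
  moreover have "0 < s i" if "i \<in> F" for i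
    using that s[of i] by (simp add: F_def order_less_le)
  ultimately show thesis by (intro that[of F]) (auto simp: F_def)
qed

theorem theorem3p3:
  fixes M :: "(nat \<Rightarrow> bool) measure"
    and A :: "nat \<Rightarrow> (nat \<Rightarrow> bool) set"
    and s :: "nat \<Rightarrow> real"
    and \<epsilon> :: real
  assumes "prob_space M" and "sets M = sets borel"
    and "mutually_independent M UNIV A"
    and "\<And>i. 0 \<le> s i \<and> s i < 1"
    and "filterlim (\<lambda>n. \<Sum>i<n. s i) at_top sequentially"
    and "\<And>i. wins_game M PlayerI (s i) (A i)"
    and "0 < \<epsilon>" and "\<epsilon> \<le> 1"
  shows "wins_game M PlayerI (1 - \<epsilon>) (\<Union>m. \<Inter>i\<in>{m..}. A i)"
proof -
  interpret Cantor_probability M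
    using assms(1,2) by (simp add: Cantor_probability_def Cantor_probability_axioms_def)
  \<comment> \<open>The errors sum to \<open>\<epsilon> / 2\<close>, which leaves the strict
    inequality needed at the end.\<close>
  define d where "d m = \<epsilon> / 4 * (1 / 2) ^ m" for m :: nat
  have d: "0 < d m" "d m < 1" for m
  proof -
    show "0 < d m" using assms(7) by (simp add: d_def)
    have "d m \<le> \<epsilon> / 4 * 1" unfolding d_def using assms(7)
      by (intro mult_left_mono power_le_one) auto
    then show "d m < 1" using assms(7,8) by linarith
  qed
  have "\<exists>K. closed K \<and> prob (- K) \<le> d m \<and> K \<subseteq> (\<Union>i\<in>{m..}. - A i)" for m
  proof -
    obtain F where F: "finite F" "F \<noteq> {}" "F \<subseteq> {m..}" "\<And>i. i \<in> F \<Longrightarrow> 0 < s i"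
      "(\<Prod>i\<in>F. 1 - s i) < d m"
      using prod_one_minus_tail_small[OF assms(4,5) d] by metis
    have "wins_game M PlayerII (1 - s i) (- A i)" for i
      by (rule wins_game_II_complement[OF assms(6)])
    moreover have "0 \<le> 1 - s i" "i \<in> F \<Longrightarrow> 1 - s i < 1" for i using assms(4)[of i] F(4)[of i] by auto
    ultimately have win: "wins_game M PlayerII (\<Prod>i\<in>F. 1 - s i) (\<Union>i\<in>F. - A i)"
      using assms(3) F(1,2) unfolding mutually_independent_def
      by (elim allE[of _ F] allE[of _ "\<lambda>i. 1 - s i"] allE[of _ PlayerII]) blast
    have nonneg: "0 \<le> (\<Prod>i\<in>F. 1 - s i)"
      using assms(4) by (intro prod_nonneg) (simp add: less_imp_le)
    have "1 - d m < 1 - (\<Prod>i\<in>F. 1 - s i)" using F(5) by simp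
    then obtain K where K: "closed K" "K \<subseteq> (\<Union>i\<in>F. - A i)" "1 - d m < prob K"
      by (rule closed_subset_if_wins_game_II[OF win nonneg])
    then have "prob (- K) \<le> d m"
      using prob_compl[of K] by (simp add: sets_eq_borel space_eq_UNIV Compl_eq_Diff_UNIV)
    then show ?thesis using K F(3) by blast
  qed
  then obtain K where K: "\<And>m. closed (K m)" "\<And>m. prob (- K m) \<le> d m"
    "\<And>m. K m \<subseteq> (\<Union>i\<in>{m..}. - A i)" by metis
  have sums: "d sums (\<epsilon> / 2)"
    unfolding d_def using sums_mult[OF geometric_sums[of "1 / 2 :: real"], of "\<epsilon> / 4"] by simp
  have K_sets: "- K m \<in> sets M" for m
    using K(1)[of m] by (simp add: sets_eq_borel)
  have summ: "summable (\<lambda>m. prob (- K m))"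
    using K(2) by (intro summable_comparison_test[OF _ sums_summable[OF sums]]) auto
  have "prob (\<Union>m. - K m) \<le> (\<Sum>m. prob (- K m))"
    using K_sets summ by (intro finite_measure_subadditive_countably) auto
  also have "\<dots> \<le> \<epsilon> / 2"
    using suminf_le[OF K(2) summ sums_summable[OF sums]] sums_unique[OF sums] by simp
  finally have small: "prob (\<Union>m. - K m) \<le> \<epsilon> / 2" .
  have closed: "closed (\<Inter>m. K m)" using K(1) by auto
  have "prob (\<Inter>m. K m) = 1 - prob (\<Union>m. - K m)"
  proof -
    have "(\<Inter>m. K m) = space M - (\<Union>m. - K m)" by (auto simp: space_eq_UNIV)
    then show ?thesis using K_sets by (simp add: prob_compl sets.countable_UN)
  qed
  then have "1 - \<epsilon> < prob (\<Inter>m. K m)" using small assms(7) by simp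
  \<comment> \<open>A point of every \<open>K m\<close> misses some \<open>A i\<close> with
    \<open>i \<ge> m\<close>, for each \<open>m\<close>.\<close>
  moreover have "(\<Inter>m. K m) \<inter> (\<Union>m. \<Inter>i\<in>{m..}. A i) = {}"
    using K(3) by blast
  ultimately show ?thesis
    using closed assms(8) by (intro wins_game_I_if_closed) auto
qed

end
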